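(* There is a constant $C>0$ such that for all sufficiently large $d$, on the $d$-dimensional hypercube with $n=2^d$ vertices there exists an initial load vector such that, with probability at least $1-n^{-C}$, the deviation between the randomized rounding diffusion algorithm and the idealized process, $|x^{(t)}_v-\xi^{(t)}_v|$, is at least $(\log_2 n)/4$ for some vertex $v$ and some time $t$.
   Context: The $d$-dimensional hypercube has vertex set $\{0,1\}^d$, vertices adjacent iff they differ in one bit. Diffusion matrix $P$: $P_{i,j}=1/(2d)$ for adjacent $i,j$, $P_{i,i}=1/2$, $0$ otherwise. Idealized process: $\xi^{(t)}=\xi^{(t-1)}P$. Discrete process: integer loads $x^{(t)}$ with $x^{(t)}_i=x^{(t-1)}_i-\sum_{j:\{i,j\}\in E}\Phi^{(t)}_{i,j}$, where $\Phi^{(t)}_{i,j}=-\Phi^{(t)}_{j,i}$ is the integer flow from $i$ to $j$ at step $t$. Randomized rounding diffusion algorithm: for each edge $\{i,j\}$ and step $t$, orient the edge so that $y:=P_{i,j}x^{(t-1)}_i-P_{j,i}x^{(t-1)}_j\ge0$ and set $\Phi^{(t)}_{i,j}=\lceil y\rceil$ with probability $y-\lfloor y\rfloor$ and $\Phi^{(t)}_{i,j}=\lfloor y\rfloor$ otherwise, independently over all edges and steps. Both processes start from the same initial vector $x^{(0)}=\xi^{(0)}$. *)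

theory Defs
  imports "HOL-Probability.Probability" "HOL-Probability.Product_PMF"
begin

type_synonym vertex = "bool list"

definition hypercube :: "nat \<Rightarrow> vertex set" where
  "hypercube d = {v. length v = d}"

definition adjacent :: "nat \<Rightarrow> vertex \<Rightarrow> vertex \<Rightarrow> bool" where
  "adjacent d i j \<longleftrightarrow> i \<in> hypercube d \<and> j \<in> hypercube d \<and> card {k. k < d \<and> i ! k \<noteq> j ! k} = 1"

definition diffusion_matrix :: "nat \<Rightarrow> vertex \<Rightarrow> vertex \<Rightarrow> real" where
  "diffusion_matrix d i j =
     (if adjacent d i j then 1 / (2 * real d) else if i = j then 1 / 2 else 0)"

text \<open>Load vectors are functions on all bit lists; only their values on
  \<^term>\<open>hypercube d\<close> are meaningful.\<close>

primrec ideal_load :: "nat \<Rightarrow> (vertex \<Rightarrow> real) \<Rightarrow> nat \<Rightarrow> vertex \<Rightarrow> real" where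
  "ideal_load d x0 0 = x0"
| "ideal_load d x0 (Suc t) =
     (\<lambda>v. \<Sum>u\<in>hypercube d. ideal_load d x0 t u * diffusion_matrix d u v)"

definition net_flow :: "nat \<Rightarrow> (vertex \<Rightarrow> int) \<Rightarrow> vertex \<Rightarrow> vertex \<Rightarrow> real" where
  "net_flow d x i j = diffusion_matrix d i j * of_int (x i) - diffusion_matrix d j i * of_int (x j)"

text \<open>An edge whose net flow is 0 occurs in both orientations; this is harmless because
  its rounded flow is then 0 almost surely.\<close>

definition oriented_edges :: "nat \<Rightarrow> (vertex \<Rightarrow> int) \<Rightarrow> (vertex \<times> vertex) set" where
  "oriented_edges d x = {(i, j). adjacent d i j \<and> net_flow d x i j \<ge> 0}"

definition randomized_round :: "real \<Rightarrow> int pmf" where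
  "randomized_round y =
     map_pmf (\<lambda>up. if up then \<lceil>y\<rceil> else \<lfloor>y\<rfloor>) (bernoulli_pmf (y - of_int \<lfloor>y\<rfloor>))"

definition rounded_flows :: "nat \<Rightarrow> (vertex \<Rightarrow> int) \<Rightarrow> (vertex \<times> vertex \<Rightarrow> int) pmf" where
  "rounded_flows d x =
     Pi_pmf (oriented_edges d x) 0 (\<lambda>(i, j). randomized_round (net_flow d x i j))"

definition edge_flow ::
    "nat \<Rightarrow> (vertex \<Rightarrow> int) \<Rightarrow> (vertex \<times> vertex \<Rightarrow> int) \<Rightarrow> vertex \<Rightarrow> vertex \<Rightarrow> int" where
  "edge_flow d x F i j = (if (i, j) \<in> oriented_edges d x then F (i, j) else - F (j, i))"

definition rounding_step :: "nat \<Rightarrow> (vertex \<Rightarrow> int) \<Rightarrow> (vertex \<Rightarrow> int) pmf" where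
  "rounding_step d x =
     map_pmf (\<lambda>F i. x i - (\<Sum>j | adjacent d i j. edge_flow d x F i j)) (rounded_flows d x)"

text \<open>The law of the whole trajectory \<open>x\<^sup>(\<^sup>0\<^sup>), x\<^sup>(\<^sup>1\<^sup>), \<dots>\<close>, obtained from the one-step kernels by the
  Ionescu-Tulcea theorem. Drawing each step afresh from the current load vector is what makes
  the rounding decisions independent over the steps.\<close>

definition trajectory_kernel ::
    "nat \<Rightarrow> (vertex \<Rightarrow> int) \<Rightarrow> nat \<Rightarrow> (nat \<Rightarrow> vertex \<Rightarrow> int) \<Rightarrow> (vertex \<Rightarrow> int) measure" where
  "trajectory_kernel d x0 t \<omega> =
     measure_pmf (case t of 0 \<Rightarrow> return_pmf x0 | Suc s \<Rightarrow> rounding_step d (\<omega> s))"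

definition rounding_process ::
    "nat \<Rightarrow> (vertex \<Rightarrow> int) \<Rightarrow> (nat \<Rightarrow> vertex \<Rightarrow> int) measure" where
  "rounding_process d x0 =
     projective_family.lim UNIV
       (Ionescu_Tulcea.CI (trajectory_kernel d x0) (\<lambda>_. count_space UNIV)) (\<lambda>_. count_space UNIV)"

lemma finite_hypercube: "finite (hypercube d)"
  using finite_lists_length_eq[of "UNIV :: bool set" d] by (simp add: hypercube_def)

lemma card_hypercube: "card (hypercube d) = 2 ^ d"
  using card_lists_length_eq[of "UNIV :: bool set" d] by (simp add: hypercube_def card_UNIV_bool)

lemma adjacent_sym: "adjacent d i j \<longleftrightarrow> adjacent d j i"
proof -
  have "{k. k < d \<and> i ! k \<noteq> j ! k} = {k. k < d \<and> j ! k \<noteq> i ! k}" by auto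
  then show ?thesis by (auto simp: adjacent_def)
qed

lemma finite_oriented_edges: "finite (oriented_edges d x)"
  by (rule finite_subset[of _ "hypercube d \<times> hypercube d"])
     (auto simp: oriented_edges_def adjacent_def finite_hypercube)

lemma net_flow_antisym: "net_flow d x j i = - net_flow d x i j"
  by (simp add: net_flow_def)

lemma edge_flow_antisym:
  assumes F: "F \<in> set_pmf (rounded_flows d x)" and adj: "adjacent d i j"
  shows "edge_flow d x F j i = - edge_flow d x F i j"
proof (cases "net_flow d x i j = 0")
  case True
  have zero: "F (a, b) = 0" if "(a, b) \<in> oriented_edges d x" "net_flow d x a b = 0" for a b
  proof -
    have "F (a, b) \<in> set_pmf (randomized_round (net_flow d x a b))"
      using F that(1) unfolding rounded_flows_def set_Pi_pmf[OF finite_oriented_edges]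
      by (force simp: PiE_dflt_def)
    then show ?thesis using that(2) by (auto simp: randomized_round_def)
  qed
  show ?thesis
    using zero[of i j] zero[of j i] True adj
    by (simp add: edge_flow_def oriented_edges_def net_flow_antisym[of d x i j] adjacent_sym[of d j i])
next
  case False
  then show ?thesis
    using adj
    by (auto simp: edge_flow_def oriented_edges_def net_flow_antisym[of d x i j] adjacent_sym[of d j i])
qed

lemma Ionescu_Tulcea_rounding: "Ionescu_Tulcea (trajectory_kernel d x0) (\<lambda>_. count_space UNIV)"
proof (rule Ionescu_Tulcea.intro)
  fix i
  show "trajectory_kernel d x0 i
          \<in> measurable (PiM {0..<i} (\<lambda>_. count_space UNIV)) (subprob_algebra (count_space UNIV))"
  proof (cases i)
    case 0
    then show ?thesis
      by (auto simp: trajectory_kernel_def[abs_def] space_subprob_algebra intro!: measurable_const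
          measure_pmf.subprob_space_axioms)
  next
    case (Suc s)
    have "(\<lambda>\<omega>. \<omega> s) \<in> measurable (PiM {0..<i} (\<lambda>_. count_space UNIV)) (count_space UNIV)"
      using Suc by (intro measurable_component_singleton) auto
    moreover have "(\<lambda>x. measure_pmf (rounding_step d x))
        \<in> measurable (count_space UNIV) (subprob_algebra (count_space UNIV))"
      by (auto simp: space_subprob_algebra intro!: measure_pmf.subprob_space_axioms)
    ultimately have "(\<lambda>\<omega>. measure_pmf (rounding_step d (\<omega> s)))
        \<in> measurable (PiM {0..<i} (\<lambda>_. count_space UNIV)) (subprob_algebra (count_space UNIV))"
      by (rule measurable_compose)
    then show ?thesis
      using Suc by (simp add: trajectory_kernel_def[abs_def])
  qed
next
  fix i and \<omega> :: "nat \<Rightarrow> vertex \<Rightarrow> int"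
  show "prob_space (trajectory_kernel d x0 i \<omega>)"
    by (simp add: trajectory_kernel_def measure_pmf.prob_space_axioms)
qed

lemma sets_rounding_process [measurable_cong]:
  "sets (rounding_process d x0) = sets (PiM UNIV (\<lambda>_. count_space UNIV))"
proof -
  interpret Ionescu_Tulcea "trajectory_kernel d x0" "\<lambda>_. count_space UNIV"
    by (rule Ionescu_Tulcea_rounding)
  show ?thesis by (simp add: rounding_process_def)
qed

lemma prob_space_rounding_process: "prob_space (rounding_process d x0)"
proof
  interpret Ionescu_Tulcea "trajectory_kernel d x0" "\<lambda>_. count_space UNIV"
    by (rule Ionescu_Tulcea_rounding)
  let ?S = "space (PiM {} (\<lambda>_::nat. count_space UNIV)) :: (nat \<Rightarrow> vertex \<Rightarrow> int) set"
  have "emeasure PF.lim (PF.emb UNIV {} ?S) = emeasure (CI {}) ?S"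
    by (rule lim) auto
  also have "\<dots> = 1"
    using prob_space.emeasure_space_1[OF PF.prob_space_P[of "{}"]] by (simp add: PF.space_P)
  also have "PF.emb UNIV {} ?S = space PF.lim"
    by (auto simp: prod_emb_def space_PiM)
  finally show "emeasure (rounding_process d x0) (space (rounding_process d x0)) = 1"
    by (simp add: rounding_process_def)
qed

text \<open>Finite paths have the law of the Markov chain with initial state \<^term>\<open>x0\<close> and transition
  kernel \<^term>\<open>rounding_step d\<close>.\<close>

lemma rounding_process_path:
  fixes p :: "nat \<Rightarrow> vertex \<Rightarrow> int"
  shows "emeasure (rounding_process d x0) {x. \<forall>t\<le>T. x t = p t} =
    ennreal (pmf (return_pmf x0) (p 0) * (\<Prod>t<T. pmf (rounding_step d (p t)) (p (Suc t))))"
proof -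
  let ?N = "\<lambda>_::nat. count_space (UNIV :: (vertex \<Rightarrow> int) set)"
  interpret Ionescu_Tulcea "trajectory_kernel d x0" ?N
    by (rule Ionescu_Tulcea_rounding)
  define q where "q n = restrict p {0..<n}" for n
  have q_space: "q n \<in> space (PiM {0..<n} ?N)" for n
    by (auto simp: q_def space_PiM)
  have q_sets [measurable]: "{q n} \<in> sets (PiM {0..<n} ?N)" for n
  proof -
    have "{q n} = PiE {0..<n} (\<lambda>t. {p t})"
      by (auto simp: q_def PiE_iff restrict_def extensional_def fun_eq_iff)
    then show ?thesis by (simp add: sets_PiM_I_finite)
  qed
  have step: "emeasure (eP n \<omega>) {q (Suc n)} =
      ennreal (measure (trajectory_kernel d x0 n (q n)) {p n}) * indicator {q n} \<omega>"
    if \<omega>: "\<omega> \<in> space (PiM {0..<n} ?N)" for n \<omega>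
  proof -
    have "fun_upd \<omega> n y = q (Suc n) \<longleftrightarrow> \<omega> = q n \<and> y = p n" for y
    proof
      assume "fun_upd \<omega> n y = q (Suc n)"
      then have eq: "fun_upd \<omega> n y t = q (Suc n) t" for t by simp
      have "\<omega> t = q n t" for t
        using eq[of t] \<omega> by (cases "t < n") (auto simp: q_def space_PiM PiE_def extensional_def split: if_splits)
      then show "\<omega> = q n \<and> y = p n" using eq[of n] by (auto simp: q_def)
    next
      assume "\<omega> = q n \<and> y = p n"
      then show "fun_upd \<omega> n y = q (Suc n)"
        by (auto simp: q_def fun_eq_iff restrict_def less_Suc_eq)
    qed
    then have "fun_upd \<omega> n -` {q (Suc n)} \<inter> space (?N n) = (if \<omega> = q n then {p n} else {})"
      by auto
    then show ?thesis
      using \<omega> by (cases "\<omega> = q n") (simp_all add: emeasure_eP trajectory_kernel_def measure_pmf.emeasure_eq_measure)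
  qed
  have C_path: "emeasure (C 0 n (\<lambda>_. undefined)) {q n} =
      ennreal (\<Prod>t<n. measure (trajectory_kernel d x0 t (q t)) {p t})" for n
  proof (induction n)
    case 0
    have "q 0 = (\<lambda>_. undefined)" by (simp add: q_def restrict_def)
    then show ?case using q_sets[of 0] by (simp add: emeasure_return)
  next
    case (Suc n)
    have "emeasure (C 0 (Suc n) (\<lambda>_. undefined)) {q (Suc n)} =
        (\<integral>\<^sup>+\<omega>. emeasure (eP n \<omega>) {q (Suc n)} \<partial>C 0 n (\<lambda>_. undefined))"
      using measurable_eP[of n] by (simp add: emeasure_bind[where N="PiM {0..<Suc n} ?N"]
          space_C measurable_cong_sets[OF sets_C refl] q_sets[of "Suc n"])
    also have "\<dots> = (\<integral>\<^sup>+\<omega>. ennreal (measure (trajectory_kernel d x0 n (q n)) {p n}) * indicator {q n} \<omega>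
        \<partial>C 0 n (\<lambda>_. undefined))"
      by (rule nn_integral_cong) (simp add: step space_C)
    also have "\<dots> = ennreal (measure (trajectory_kernel d x0 n (q n)) {p n}) *
        emeasure (C 0 n (\<lambda>_. undefined)) {q n}"
      by (rule nn_integral_cmult_indicator) (simp add: sets_C)
    also have "\<dots> = ennreal (\<Prod>t<Suc n. measure (trajectory_kernel d x0 t (q t)) {p t})"
      by (simp add: Suc ennreal_mult'' prod_nonneg mult.commute)
    finally show ?case .
  qed
  have "(\<forall>t\<le>T. x t = p t) \<longleftrightarrow> restrict x {0..<Suc T} = q (Suc T)" for x
    unfolding q_def by (metis atLeastLessThan_iff le0 less_Suc_eq_le restrict_apply' restrict_ext)
  then have "{x. \<forall>t\<le>T. x t = p t} = PF.emb UNIV {0..<Suc T} {q (Suc T)}"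
    by (auto simp: prod_emb_def)
  then have "emeasure (rounding_process d x0) {x. \<forall>t\<le>T. x t = p t} = emeasure (CI {0..<Suc T}) {q (Suc T)}"
    by (simp add: rounding_process_def lim)
  also have "\<dots> = emeasure (C 0 (Suc T) (\<lambda>_. undefined)) {q (Suc T)}"
    using q_space[of "Suc T"] prod_emb_id[of "{q (Suc T)}" "{0..<Suc T}" ?N]
    by (subst emeasure_CI[of _ "Suc T"]) (auto simp: space_PiM simp del: C.simps)
  also have "\<dots> = ennreal (\<Prod>t<Suc T. measure (trajectory_kernel d x0 t (q t)) {p t})"
    by (rule C_path)
  also have "(\<Prod>t<Suc T. measure (trajectory_kernel d x0 t (q t)) {p t}) =
      pmf (return_pmf x0) (p 0) * (\<Prod>t<T. pmf (rounding_step d (p t)) (p (Suc t)))"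
    by (subst prod.lessThan_Suc_shift) (simp add: trajectory_kernel_def q_def measure_pmf_single)
  finally show ?thesis .
qed

end

theory Submission
  imports Defs
begin

text \<open>Put \<open>d\<close> tokens on every vertex with an even number of ones and none elsewhere. Every edge
  then has net flow \<open>1/2\<close> out of its even endpoint, so its rounded flow is a fair coin and each
  even vertex \<open>v\<close> ends the first step with deviation \<open>d/2 - B\<^sub>v\<close>, where \<open>B\<^sub>v\<close> is
  binomial with parameters \<open>d\<close> and \<open>1/2\<close>. No two even vertices share an edge, so the \<open>B\<^sub>v\<close> are
  independent. Since \<open>B\<^sub>v\<close> equals \<open>k = \<lfloor>d/4\<rfloor>\<close> with probability at least \<open>4\<^sup>k / 2\<^sup>d\<close> and there are
  \<open>2\<^sup>d / 2\<close> even vertices, the probability that no \<open>B\<^sub>v\<close> equals \<open>k\<close> is at most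
  \<open>exp (- 4\<^sup>k / 2) \<le> 1/n\<close>.\<close>

section \<open>Blocks of a product distribution\<close>

text \<open>Cutting \<open>A\<close> and \<open>B\<close> down to the supports makes them countable
  without changing any probability, so the product rule for countable sets extends to arbitrary
  ones.\<close>

lemma measure_pair_pmf_Times:
  "measure_pmf.prob (pair_pmf M N) (A \<times> B) = measure_pmf.prob M A * measure_pmf.prob N B"
proof -
  have "measure_pmf.prob (pair_pmf M N) (A \<times> B) =
      measure_pmf.prob (pair_pmf M N) ((A \<inter> set_pmf M) \<times> (B \<inter> set_pmf N))"
    by (subst measure_Int_set_pmf[symmetric]) (rule arg_cong[where f="measure_pmf.prob _"], auto)
  also have "\<dots> = measure_pmf.prob M (A \<inter> set_pmf M) * measure_pmf.prob N (B \<inter> set_pmf N)"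
    by (intro measure_pmf_prob_product countable_Int2 countable_set_pmf)
  finally show ?thesis by (simp add: measure_Int_set_pmf)
qed

text \<open>Events that depend on disjoint blocks of coordinates are independent; the last
  assumption says that \<open>S v\<close> looks only at the block \<open>K v\<close>. The induction
  splits off one block at a time.\<close>

lemma measure_Pi_pmf_INT_blocks:
  fixes S :: "'i \<Rightarrow> ('a \<Rightarrow> 'b) set"
  assumes "finite V" and "\<And>v. v \<in> V \<Longrightarrow> finite (K v)" and "disjoint_family_on K V"
    and "\<And>v f g. v \<in> V \<Longrightarrow> (\<And>x. x \<in> K v \<Longrightarrow> f x = g x) \<Longrightarrow> f \<in> S v \<longleftrightarrow> g \<in> S v"
  shows "measure_pmf.prob (Pi_pmf (\<Union>v\<in>V. K v) dflt p) (\<Inter>v\<in>V. S v) =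
    (\<Prod>v\<in>V. measure_pmf.prob (Pi_pmf (K v) dflt p) (S v))"
  using assms
proof (induction V rule: finite_induct)
  case empty
  then show ?case by simp
next
  case (insert v V)
  let ?U = "\<Union>u\<in>V. K u"
  have disj: "K v \<inter> ?U = {}"
    using insert.hyps insert.prems(2) by (auto simp: disjoint_family_on_def)
  let ?h = "\<lambda>(f :: 'a \<Rightarrow> 'b, g) x. if x \<in> K v then f x else g x"
  \<comment> \<open>The merged function agrees with \<open>f\<close> on \<open>K v\<close> and, by
    disjointness, with \<open>g\<close> on the other blocks, so the preimage is a rectangle.\<close>
  have pre: "?h -` (\<Inter>u\<in>insert v V. S u) = S v \<times> (\<Inter>u\<in>V. S u)"
  proof (rule set_eqI)
    fix fg :: "('a \<Rightarrow> 'b) \<times> ('a \<Rightarrow> 'b)"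
    obtain f g where fg: "fg = (f, g)" by fastforce
    have "?h (f, g) \<in> S v \<longleftrightarrow> f \<in> S v"
      by (rule insert.prems(3)) auto
    moreover have "?h (f, g) \<in> S u \<longleftrightarrow> g \<in> S u" if "u \<in> V" for u
      by (rule insert.prems(3)) (use disj that in auto)
    ultimately show "fg \<in> ?h -` (\<Inter>u\<in>insert v V. S u) \<longleftrightarrow> fg \<in> S v \<times> (\<Inter>u\<in>V. S u)"
      by (auto simp: fg)
  qed
  have "Pi_pmf (\<Union>u\<in>insert v V. K u) dflt p =
      map_pmf ?h (pair_pmf (Pi_pmf (K v) dflt p) (Pi_pmf ?U dflt p))"
    using insert.hyps insert.prems(1) disj by (simp add: Pi_pmf_union)
  then have "measure_pmf.prob (Pi_pmf (\<Union>u\<in>insert v V. K u) dflt p) (\<Inter>u\<in>insert v V. S u) =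
      measure_pmf.prob (Pi_pmf (K v) dflt p) (S v) * measure_pmf.prob (Pi_pmf ?U dflt p) (\<Inter>u\<in>V. S u)"
    by (simp only: measure_map_pmf pre measure_pair_pmf_Times)
  also have "measure_pmf.prob (Pi_pmf ?U dflt p) (\<Inter>u\<in>V. S u) =
      (\<Prod>u\<in>V. measure_pmf.prob (Pi_pmf (K u) dflt p) (S u))"
  proof (rule insert.IH)
    show "disjoint_family_on K V"
      using insert.prems(2) by (auto simp: disjoint_family_on_def)
    show "finite (K u)" if "u \<in> V" for u
      using insert.prems(1) that by simp
    show "f \<in> S u \<longleftrightarrow> g \<in> S u" if "u \<in> V" "\<And>x. x \<in> K u \<Longrightarrow> f x = g x" for u f g
      by (rule insert.prems(3)) (use that in simp_all)
  qed
  finally show ?case using insert.hyps by simp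
qed

section \<open>Parity in the hypercube\<close>

definition even_vertex :: "vertex \<Rightarrow> bool" where
  "even_vertex v \<longleftrightarrow> even (count_list v True)"

lemma even_vertex_flip:
  "k < length v \<Longrightarrow> even_vertex (v[k := \<not> v ! k]) \<longleftrightarrow> \<not> even_vertex v"
proof (induction v arbitrary: k)
  case Nil
  then show ?case by simp
next
  case (Cons a v)
  then show ?case by (cases k) (auto simp: even_vertex_def)
qed

lemma adjacent_iff_flip:
  "adjacent d i j \<longleftrightarrow> length i = d \<and> (\<exists>k<d. j = i[k := \<not> i ! k])"
proof
  assume adj: "adjacent d i j"
  then obtain k where k: "{k. k < d \<and> i ! k \<noteq> j ! k} = {k}"
    by (auto simp: adjacent_def card_1_singleton_iff)
  have len: "length i = d" "length j = d"
    using adj by (auto simp: adjacent_def hypercube_def)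
  have diff: "i ! l \<noteq> j ! l \<longleftrightarrow> l = k" if "l < d" for l
    using k that by blast
  have "j = i[k := \<not> i ! k]"
  proof (rule nth_equalityI)
    fix l assume "l < length j"
    then show "j ! l = i[k := \<not> i ! k] ! l"
      using len diff[of l] by (cases "l = k") auto
  qed (simp add: len)
  then show "length i = d \<and> (\<exists>k<d. j = i[k := \<not> i ! k])"
    using k len by auto
next
  assume "length i = d \<and> (\<exists>k<d. j = i[k := \<not> i ! k])"
  then obtain k where k: "length i = d" "k < d" "j = i[k := \<not> i ! k]" by auto
  then have "{l. l < d \<and> i ! l \<noteq> j ! l} = {k}"
    by (auto simp: nth_list_update split: if_splits)
  then show "adjacent d i j"
    using k by (simp add: adjacent_def hypercube_def)
qed

lemma even_vertex_adjacent: "adjacent d i j \<Longrightarrow> even_vertex j \<longleftrightarrow> \<not> even_vertex i"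
  by (auto simp: adjacent_iff_flip even_vertex_flip)

lemma card_adjacent:
  assumes "v \<in> hypercube d"
  shows "card {j. adjacent d v j} = d"
proof -
  have len: "length v = d" using assms by (simp add: hypercube_def)
  have "{j. adjacent d v j} = (\<lambda>k. v[k := \<not> v ! k]) ` {..<d}"
    using len by (auto simp: adjacent_iff_flip)
  moreover have "inj_on (\<lambda>k. v[k := \<not> v ! k]) {..<d}"
  proof (rule inj_onI)
    fix k l assume kl: "k \<in> {..<d}" "l \<in> {..<d}" and eq: "v[k := \<not> v ! k] = v[l := \<not> v ! l]"
    show "k = l"
    proof (rule ccontr)
      assume "k \<noteq> l"
      then have "v[l := \<not> v ! l] ! k = v ! k" by simp
      moreover have "v[k := \<not> v ! k] ! k = (\<not> v ! k)" using kl len by simp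
      ultimately show False by (simp add: eq)
    qed
  qed
  ultimately show ?thesis by (simp add: card_image)
qed

definition even_vertices :: "nat \<Rightarrow> vertex set" where
  "even_vertices d = {v \<in> hypercube d. even_vertex v}"

lemma finite_even_vertices: "finite (even_vertices d)"
  by (simp add: even_vertices_def finite_hypercube)

text \<open>The last \<open>d\<close> bits are free and determine the first one by parity.\<close>

lemma card_even_vertices: "card (even_vertices (Suc d)) = 2 ^ d"
proof -
  have parity: "even_vertex (a # w) \<longleftrightarrow> a = (\<not> even_vertex w)" for a w
    by (simp add: even_vertex_def)
  have "even_vertices (Suc d) = (\<lambda>w. (\<not> even_vertex w) # w) ` hypercube d"
  proof (intro equalityI subsetI)
    fix v assume "v \<in> even_vertices (Suc d)"
    then obtain a w where "v = a # w" "length w = d" "even_vertex (a # w)"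
      by (auto simp: even_vertices_def hypercube_def length_Suc_conv)
    then show "v \<in> (\<lambda>w. (\<not> even_vertex w) # w) ` hypercube d"
      by (auto simp: parity hypercube_def)
  qed (auto simp: even_vertices_def hypercube_def parity)
  moreover have "inj_on (\<lambda>w. (\<not> even_vertex w) # w) (hypercube d)"
    by (rule inj_onI) simp
  ultimately show ?thesis by (simp add: card_image card_hypercube)
qed

text \<open>For even \<open>v\<close> these sets serve as the blocks of independent coins: pairs
  with different tails are distinct.\<close>

definition out_edges :: "nat \<Rightarrow> vertex \<Rightarrow> (vertex \<times> vertex) set" where
  "out_edges d v = {v} \<times> {j. adjacent d v j}"

lemma finite_adjacent: "finite {j. adjacent d v j}"
  by (rule finite_subset[OF _ finite_hypercube]) (auto simp: adjacent_def)

lemma finite_out_edges: "finite (out_edges d v)"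
  by (simp add: out_edges_def finite_adjacent)

lemma card_out_edges: "v \<in> hypercube d \<Longrightarrow> card (out_edges d v) = d"
  by (simp add: out_edges_def card_cartesian_product card_adjacent)

section \<open>The first step from the parity load\<close>

text \<open>The height \<open>d\<close> cancels the \<open>d\<close> in the matrix entry
  \<open>1 / (2 * d)\<close>, which makes every flow a half-integer.\<close>

definition parity_load :: "nat \<Rightarrow> vertex \<Rightarrow> int" where
  "parity_load d v = (if even_vertex v then int d else 0)"

lemma net_flow_parity_load:
  assumes "d > 0" "adjacent d i j"
  shows "net_flow d (parity_load d) i j = (if even_vertex i then 1 / 2 else - 1 / 2)"
  using assms even_vertex_adjacent[OF assms(2)] adjacent_sym[of d i j]
  by (auto simp: net_flow_def diffusion_matrix_def parity_load_def)

text \<open>No net flow vanishes, so each edge occurs in exactly one orientation, the one leaving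
  its even endpoint.\<close>

lemma oriented_edges_parity_load:
  assumes "d > 0"
  shows "oriented_edges d (parity_load d) = (\<Union>v\<in>even_vertices d. out_edges d v)"
  using net_flow_parity_load[OF assms]
  by (auto simp: oriented_edges_def out_edges_def even_vertices_def adjacent_def split: if_splits)

lemma randomized_round_half: "randomized_round (1 / 2) = map_pmf of_bool (bernoulli_pmf (1 / 2))"
proof -
  have floor: "\<lfloor>1 / 2 :: real\<rfloor> = 0" and ceiling: "\<lceil>1 / 2 :: real\<rceil> = 1" by linarith+
  show ?thesis unfolding randomized_round_def floor ceiling by (simp add: of_bool_def[abs_def])
qed

definition coins :: "'a set \<Rightarrow> ('a \<Rightarrow> bool) pmf" where
  "coins A = Pi_pmf A False (\<lambda>_. bernoulli_pmf (1 / 2))"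

lemma rounded_flows_parity_load:
  assumes "d > 0"
  shows "rounded_flows d (parity_load d) =
    map_pmf (\<lambda>F. of_bool \<circ> F) (coins (\<Union>v\<in>even_vertices d. out_edges d v))"
proof -
  let ?E = "oriented_edges d (parity_load d)"
  have "rounded_flows d (parity_load d) =
      Pi_pmf ?E 0 (\<lambda>_. map_pmf of_bool (bernoulli_pmf (1 / 2)))"
    unfolding rounded_flows_def
  proof (rule Pi_pmf_cong)
    fix e assume e: "e \<in> ?E"
    obtain i j where ij: "e = (i, j)" by fastforce
    have "adjacent d i j" "net_flow d (parity_load d) i j \<ge> 0"
      using e by (simp_all add: ij oriented_edges_def)
    then have "net_flow d (parity_load d) i j = 1 / 2"
      using net_flow_parity_load[OF assms, of i j] by (simp split: if_splits)
    then show "(case e of (i, j) \<Rightarrow> randomized_round (net_flow d (parity_load d) i j)) =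
        map_pmf of_bool (bernoulli_pmf (1 / 2))"
      by (simp only: ij prod.case randomized_round_half)
  qed simp_all
  also have "\<dots> = map_pmf (\<lambda>F. of_bool \<circ> F) (coins ?E)"
    \<comment> \<open>The default values match, since \<open>of_bool False\<close> is
      \<open>0\<close>.\<close>
    unfolding coins_def by (rule Pi_pmf_map) (simp_all add: finite_oriented_edges)
  finally show ?thesis by (simp only: oriented_edges_parity_load[OF assms])
qed

lemma outflow_parity_load:
  assumes "d > 0" "v \<in> even_vertices d"
  shows "(\<Sum>j | adjacent d v j. edge_flow d (parity_load d) (of_bool \<circ> F) v j) =
    int (card {e \<in> out_edges d v. F e})"
proof -
  have "(\<Sum>j | adjacent d v j. edge_flow d (parity_load d) (of_bool \<circ> F) v j) =
      (\<Sum>j | adjacent d v j. of_bool (F (v, j)))"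
    using assms
    by (intro sum.cong refl) (auto simp: edge_flow_def oriented_edges_parity_load out_edges_def)
  also have "\<dots> = (\<Sum>e\<in>out_edges d v. of_bool (F e))"
    by (rule sum.reindex_bij_witness[of _ snd "Pair v"]) (auto simp: out_edges_def)
  also have "\<dots> = int (card {e \<in> out_edges d v. F e})"
    by (simp add: sum_of_bool_eq finite_out_edges Int_def)
  finally show ?thesis .
qed

text \<open>All neighbours of an even vertex are odd, hence empty; it receives nothing and keeps
  half of its \<open>d\<close> tokens.\<close>

lemma ideal_load_parity_load:
  assumes "v \<in> even_vertices d"
  shows "ideal_load d (\<lambda>u. real_of_int (parity_load d u)) 1 v = real d / 2"
proof -
  have v: "v \<in> hypercube d" "even_vertex v" using assms by (auto simp: even_vertices_def)
  have "real_of_int (parity_load d u) * diffusion_matrix d u v = (if u = v then real d / 2 else 0)" for u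
    using v even_vertex_adjacent[of d u v]
    by (auto simp: parity_load_def diffusion_matrix_def adjacent_def)
  then show ?thesis using v by (simp add: finite_hypercube)
qed

section \<open>Tail bounds\<close>

text \<open>For \<open>k = d div 4 > 0\<close> this is \<open>(d / k) ^ k \<le> d choose k\<close>
  combined with \<open>d / k \<ge> 4\<close>.\<close>

lemma four_power_le_binomial: "4 ^ (d div 4) \<le> real (d choose (d div 4))"
proof (cases "d div 4 = 0")
  case True
  then show ?thesis by (simp add: div_eq_0_iff)
next
  case False
  have "4 * (d div 4) \<le> d" by simp
  then have "4 * real (d div 4) \<le> real d" by linarith
  then have "4 ^ (d div 4) \<le> (real d / real (d div 4)) ^ (d div 4)"
    using False by (intro power_mono) (auto simp: field_simps)
  also have "\<dots> \<le> real (d choose (d div 4))"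
    by (rule binomial_ge_n_over_k_pow_k) simp
  finally show ?thesis .
qed

text \<open>A single point mass of the binomial distribution is already large enough, so no sum over
  its tail is needed.\<close>

lemma prob_coins_neq_quarter:
  assumes "finite A" "card A = d"
  shows "measure_pmf.prob (coins A) {F. card {x \<in> A. F x} \<noteq> d div 4} \<le> 1 - 4 ^ (d div 4) / 2 ^ d"
proof -
  let ?k = "d div 4"
  have "measure_pmf.prob (coins A) {F. card {x \<in> A. F x} \<noteq> ?k} =
      measure_pmf.prob (binomial_pmf d (1 / 2)) (- {?k})"
    using assms by (subst binomial_pmf_altdef'[of A d _ False])
      (auto simp: coins_def measure_map_pmf vimage_def Compl_eq)
  also have "\<dots> = 1 - pmf (binomial_pmf d (1 / 2)) ?k"
    by (subst measure_pmf.prob_compl[of "{?k}", simplified, folded Compl_eq_Diff_UNIV])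
       (simp add: measure_pmf_single)
  also have "pmf (binomial_pmf d (1 / 2)) ?k = real (d choose ?k) / 2 ^ d"
    by (simp add: power_divide flip: power_add)
  finally show ?thesis
    using four_power_le_binomial[of d] by (simp add: divide_right_mono)
qed

text \<open>With \<open>k = d div 4\<close> one has \<open>d \<le> 4 * k + 3\<close>, so the left
  side bounds \<open>2 * d\<close>.\<close>

lemma eight_times_add_le_four_power: "3 \<le> k \<Longrightarrow> 8 * real k + 6 \<le> 4 ^ k"
  by (induction k rule: dec_induct) auto

lemma no_quarter_bound:
  assumes "12 \<le> d"
  shows "(1 - 4 ^ (d div 4) / 2 ^ d) ^ (2 ^ (d - 1)) \<le> 1 / (2 :: real) ^ d"
proof -
  let ?k = "d div 4" and ?q = "4 ^ (d div 4) / 2 ^ d :: real"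
  \<comment> \<open>This gives \<open>?q \<le> 1\<close>: monotonicity of powers needs the base
    \<open>1 - ?q\<close> to be nonnegative.\<close>
  have "(4::real) ^ ?k \<le> real (2 ^ d)"
    using four_power_le_binomial[of d] binomial_le_pow2[of d ?k] of_nat_mono order_trans by blast
  then have "(1 - ?q) ^ (2 ^ (d - 1)) \<le> exp (- ?q) ^ (2 ^ (d - 1))"
    using exp_ge_add_one_self[of "- ?q"] by (intro power_mono) auto
  also have "\<dots> = exp (- ?q * 2 ^ (d - 1))"
    by (simp flip: exp_of_nat_mult add: mult.commute)
  also have "- ?q * 2 ^ (d - 1) = - (4 ^ ?k / 2)"
    using assms by (cases d) auto
  also have "real d \<le> 4 ^ ?k / 2"
    using eight_times_add_le_four_power[of ?k] assms by linarith
  then have "exp (- (4 ^ ?k / 2)) \<le> exp (- real d)" by simp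
  also have "\<dots> = 1 / exp 1 ^ d"
    by (simp add: exp_minus inverse_eq_divide flip: exp_of_nat_mult)
  also have "\<dots> \<le> 1 / 2 ^ d"
    using exp_ge_add_one_self[of 1] by (intro divide_left_mono power_mono) auto
  finally show ?thesis .
qed

text \<open>The time is fixed to 1, so that the event can be evaluated under the one-step
  law.\<close>

definition far_loads :: "nat \<Rightarrow> (vertex \<Rightarrow> int) set" where
  "far_loads d = {y. \<exists>v\<in>hypercube d.
     \<bar>real_of_int (y v) - ideal_load d (\<lambda>u. real_of_int (parity_load d u)) 1 v\<bar> \<ge> real d / 4}"

lemma prob_far_loads:
  assumes "12 \<le> d"
  shows "measure_pmf.prob (rounding_step d (parity_load d)) (far_loads d) \<ge> 1 - 1 / 2 ^ d"
proof -
  let ?V = "even_vertices d" and ?k = "d div 4"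
  let ?S = "\<lambda>v. {F. card {e \<in> out_edges d v. F e} \<noteq> ?k}"
  let ?E = "\<Union>v\<in>?V. out_edges d v"
  let ?step = "\<lambda>F i. parity_load d i - (\<Sum>j | adjacent d i j. edge_flow d (parity_load d) (of_bool \<circ> F) i j)"
  have d: "d > 0" using assms by simp
  have law: "rounding_step d (parity_load d) = map_pmf ?step (coins ?E)"
    by (simp add: rounding_step_def rounded_flows_parity_load[OF d] map_pmf_comp)
  have far: "?step F \<in> far_loads d" if F: "F \<notin> (\<Inter>v\<in>?V. ?S v)" for F
  proof -
    obtain v where v: "v \<in> ?V" and k: "card {e \<in> out_edges d v. F e} = ?k"
      using F by auto
    \<comment> \<open>The ideal load is \<open>d / 2\<close>, so the deviation is
      \<open>d / 2 - ?k\<close>, at least \<open>d / 4\<close> because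
      \<open>4 * ?k \<le> d\<close>.\<close>
    then have "?step F v = int d - int ?k"
      using outflow_parity_load[OF d v] by (simp add: even_vertices_def parity_load_def)
    moreover have "4 * real ?k \<le> real d" by linarith
    ultimately have "\<bar>real_of_int (?step F v) - ideal_load d (\<lambda>u. real_of_int (parity_load d u)) 1 v\<bar>
        \<ge> real d / 4"
      unfolding ideal_load_parity_load[OF v] by simp
    then show ?thesis using v unfolding far_loads_def even_vertices_def by blast
  qed
  have "measure_pmf.prob (coins ?E) (\<Inter>v\<in>?V. ?S v) =
      (\<Prod>v\<in>?V. measure_pmf.prob (coins (out_edges d v)) (?S v))"
    unfolding coins_def
  proof (rule measure_Pi_pmf_INT_blocks)
    show "disjoint_family_on (out_edges d) ?V"
      by (auto simp: disjoint_family_on_def out_edges_def)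
    show "F \<in> ?S v \<longleftrightarrow> G \<in> ?S v" if "\<And>x. x \<in> out_edges d v \<Longrightarrow> F x = G x" for v F G
      using that by (simp cong: conj_cong)
  qed (auto simp: finite_even_vertices finite_out_edges)
  also have "\<dots> \<le> (\<Prod>v\<in>?V. 1 - 4 ^ ?k / 2 ^ d)"
    by (intro prod_mono conjI measure_nonneg prob_coins_neq_quarter)
       (auto simp: finite_out_edges card_out_edges even_vertices_def)
  also have "\<dots> = (1 - 4 ^ ?k / 2 ^ d) ^ (2 ^ (d - 1))"
    using card_even_vertices[of "d - 1"] d by simp
  also have "\<dots> \<le> 1 / 2 ^ d" by (rule no_quarter_bound[OF assms])
  finally have "1 - 1 / 2 ^ d \<le> measure_pmf.prob (coins ?E) (- (\<Inter>v\<in>?V. ?S v))"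
    using measure_pmf.prob_compl[of "\<Inter>v\<in>?V. ?S v" "coins ?E"] by (simp add: Compl_eq_Diff_UNIV)
  also have "\<dots> \<le> measure_pmf.prob (coins ?E) (?step -` far_loads d)"
    using far by (intro measure_pmf.finite_measure_mono) auto
  finally show ?thesis by (simp only: law measure_map_pmf)
qed

section \<open>From the one-step law to the process\<close>

text \<open>The law of the process is known on fully specified finite paths. Restricting
  \<open>A\<close> to the countable support of the step splits the event into countably many
  disjoint path events \<open>X y\<close>, whose masses add up.\<close>

lemma rounding_process_first_step:
  assumes E: "E \<in> sets (rounding_process d x0)"
    and sub: "\<And>x. x (Suc 0) \<in> A \<Longrightarrow> x \<in> E"
  shows "measure_pmf.prob (rounding_step d x0) A \<le> measure (rounding_process d x0) E"
proof -
  interpret prob_space "rounding_process d x0" by (rule prob_space_rounding_process)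
  define B where "B = A \<inter> set_pmf (rounding_step d x0)"
  define p where "p y = (\<lambda>t::nat. if t = 0 then x0 else y)" for y :: "vertex \<Rightarrow> int"
  define X where "X y = {x. \<forall>t\<le>Suc 0. x t = p y t}" for y
  have X: "X y = {x. x 0 = x0 \<and> x (Suc 0) = y}" for y
  proof -
    have "(\<forall>t\<le>Suc 0. P t) \<longleftrightarrow> P 0 \<and> P (Suc 0)" for P :: "nat \<Rightarrow> bool"
      by (auto simp: le_Suc_eq)
    then show ?thesis by (simp add: X_def p_def)
  qed
  have sets: "X y \<in> sets (rounding_process d x0)" for y
  proof -
    have "{x \<in> space (PiM UNIV (\<lambda>_::nat. count_space UNIV)). x 0 = x0 \<and> x (Suc 0) = y}
        \<in> sets (PiM UNIV (\<lambda>_. count_space UNIV))"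
      by measurable
    then show ?thesis by (simp add: X sets_rounding_process space_PiM)
  qed
  have "emeasure (measure_pmf (rounding_step d x0)) A = emeasure (measure_pmf (rounding_step d x0)) B"
    by (simp add: B_def emeasure_Int_set_pmf)
  also have "\<dots> = (\<integral>\<^sup>+y. pmf (rounding_step d x0) y \<partial>count_space B)"
    by (simp add: nn_integral_pmf)
  also have "\<dots> = (\<integral>\<^sup>+y. emeasure (rounding_process d x0) (X y) \<partial>count_space B)"
    by (simp only: X_def rounding_process_path) (simp add: p_def)
  also have "\<dots> = emeasure (rounding_process d x0) (\<Union>y\<in>B. X y)"
    by (rule emeasure_UN_countable[symmetric])
       (use sets in \<open>auto simp: B_def X disjoint_family_on_def\<close>)
  also have "\<dots> \<le> emeasure (rounding_process d x0) E"
    using sub by (intro emeasure_mono E) (auto simp: X B_def)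
  finally show ?thesis by (simp add: emeasure_eq_measure measure_pmf.emeasure_eq_measure)
qed

theorem mainTheorem3:
  shows "\<exists>C::real. C > 0 \<and>
    (\<forall>\<^sub>F d :: nat in sequentially.
      let n = (2::real) ^ d in
      \<exists>x0 :: vertex \<Rightarrow> int.
        \<P>(x in rounding_process d x0.
             \<exists>v\<in>hypercube d. \<exists>t.
               \<bar>real_of_int (x t v) - ideal_load d (\<lambda>u. real_of_int (x0 u)) t v\<bar> \<ge> log 2 n / 4)
          \<ge> 1 - n powr (- C))"
proof (intro exI[of _ 1] conjI eventually_sequentiallyI[of 12])
  \<comment> \<open>The constant is \<open>C = 1\<close>; the threshold 12 ensures
    \<open>d div 4 \<ge> 3\<close>, as the exponential estimate requires.\<close>
  fix d :: nat assume d: "12 \<le> d"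
  let ?x0 = "parity_load d"
  let ?M = "rounding_process d ?x0"
  let ?dev = "\<lambda>x t v. \<bar>real_of_int (x t v) - ideal_load d (\<lambda>u. real_of_int (?x0 u)) t v\<bar>"
  let ?E = "{x \<in> space ?M. \<exists>v\<in>hypercube d. \<exists>t. ?dev x t v \<ge> log 2 (2 ^ d) / 4}"
  have space: "space ?M = UNIV"
    using sets_eq_imp_space_eq[OF sets_rounding_process[of d ?x0]] by (simp add: space_PiM)
  have coord [measurable]: "(\<lambda>x. x t) \<in> measurable ?M (count_space UNIV)" for t
    unfolding measurable_cong_sets[OF sets_rounding_process refl]
    by (rule measurable_component_singleton) simp
  have dev: "(\<lambda>x. ?dev x t v) \<in> borel_measurable ?M" for t v
    by (rule measurable_compose[OF coord, where g="\<lambda>y. ?dev (\<lambda>_. y) t v"]) simp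
  \<comment> \<open>Measurability holds because there are finitely many vertices and countably many
    times.\<close>
  have "?E = (\<Union>v\<in>hypercube d. \<Union>t. {x \<in> space ?M. ?dev x t v \<ge> log 2 (2 ^ d) / 4})"
    by auto
  also have "\<dots> \<in> sets ?M"
    by (intro sets.finite_UN finite_hypercube sets.countable_UN image_subsetI
        borel_measurable_le borel_measurable_const dev)
  finally have E: "?E \<in> sets ?M" .
  have "1 - (2 ^ d) powr (- 1) \<le> measure_pmf.prob (rounding_step d ?x0) (far_loads d)"
    using prob_far_loads[OF d] by (simp add: powr_minus_divide)
  also have "\<dots> \<le> measure ?M ?E"
  proof (rule rounding_process_first_step[OF E])
    fix x :: "nat \<Rightarrow> vertex \<Rightarrow> int" assume "x (Suc 0) \<in> far_loads d"
    then obtain v where "v \<in> hypercube d" "?dev x 1 v \<ge> real d / 4"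
      by (auto simp: far_loads_def)
    then show "x \<in> ?E"
      \<comment> \<open>The witness is time 1, and \<open>log 2 (2 ^ d)\<close> equals
        \<open>d\<close>.\<close>
      by (auto simp: space log_nat_power simp del: ideal_load.simps intro!: bexI[of _ v] exI[of _ 1])
  qed
  finally show "let n = (2::real) ^ d in \<exists>x0 :: vertex \<Rightarrow> int.
        \<P>(x in rounding_process d x0. \<exists>v\<in>hypercube d. \<exists>t.
             \<bar>real_of_int (x t v) - ideal_load d (\<lambda>u. real_of_int (x0 u)) t v\<bar> \<ge> log 2 n / 4)
          \<ge> 1 - n powr (- 1)"
    unfolding Let_def by blast
qed simp

end
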